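(* Let $J:\mathbb{R}^n\to\mathbb{R}$ be a radially symmetric measurable function and assume that there exists $\delta\ge 2$ such that $J\in L^1_\delta(\mathbb{R}^n)$, i.e. $\int_{\mathbb{R}^n}|J(x)|\langle x\rangle^\delta\,dx<\infty$. Then, for any $b\in\mathbb{R}$ with $|b|\le\delta-2$ and any $1\le q\le\infty$, there is a constant $C$ (independent of $t$ and $f$) such that $$\|\mathcal{G}(t)f\|_{L^q_b}\le C\langle t\rangle^{|b|/2}\|f\|_{L^q_b}$$ for all $t\ge0$ and all $f\in L^q_b(\mathbb{R}^n)$.
   Context: Notation: $\langle x\rangle=(1+|x|^2)^{1/2}$ for $x\in\mathbb{R}^n$, and likewise $\langle t\rangle=(1+t^2)^{1/2}$ for $t\in\mathbb{R}$. For $1\le q\le\infty$, $b\in\mathbb{R}$, $L^q_b(\mathbb{R}^n)$ is the set of measurable $f:\mathbb{R}^n\to\mathbb{R}$ with $\|f\|_{L^q_b}:=\|\langle\cdot\rangle^b f\|_{L^q}<\infty$. Green operator: let $\alpha_0=\|J\|_{L^1}$ and $\mathcal{J}\varphi=J*\varphi=\int_{\mathbb{R}^n}J(x-y)\varphi(y)\,dy$, with $\mathcal{J}^0=\mathrm{id}$ and $\mathcal{J}^k$ the $k$-fold iterate of $\mathcal J$. Then $$\mathcal{G}(t)f=e^{-\alpha_0t}\sum_{k=0}^\infty\frac{t^k}{k!}\mathcal{J}^kf .$$ *)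

theory Defs
  imports "HOL-Analysis.Analysis" "HOL-Probability.Essential_Supremum"
begin

definition japanese_bracket :: "'a::real_normed_vector \<Rightarrow> real"
  where "japanese_bracket x = sqrt (1 + (norm x)\<^sup>2)"

text \<open>
  Functions are not identified when they agree almost everywhere; measurability is with respect to
  Lebesgue measurable sets. The exponent ranges over the extended half-line, so that
  \<open>q = \<infinity>\<close> is covered; the norms take values in \<^typ>\<open>ennreal\<close>.
\<close>

definition Lq_norm :: "ennreal \<Rightarrow> ('a::euclidean_space \<Rightarrow> real) \<Rightarrow> ennreal"
  where "Lq_norm q f =
    (if q = \<infinity> then esssup lebesgue (\<lambda>x. ennreal \<bar>f x\<bar>)
     else let I = (\<integral>\<^sup>+x. ennreal (\<bar>f x\<bar> powr enn2real q) \<partial>lebesgue)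
          in if I = \<infinity> then \<infinity> else ennreal (enn2real I powr (1 / enn2real q)))"

definition weighted_Lq_norm :: "ennreal \<Rightarrow> real \<Rightarrow> ('a::euclidean_space \<Rightarrow> real) \<Rightarrow> ennreal"
  where "weighted_Lq_norm q b f = Lq_norm q (\<lambda>x. japanese_bracket x powr b * f x)"

definition weighted_Lq :: "ennreal \<Rightarrow> real \<Rightarrow> ('a::euclidean_space \<Rightarrow> real) set"
  where "weighted_Lq q b = {f \<in> borel_measurable lebesgue. weighted_Lq_norm q b f < \<infinity>}"

definition radially_symmetric :: "('a::real_normed_vector \<Rightarrow> 'b) \<Rightarrow> bool"
  where "radially_symmetric J \<longleftrightarrow> (\<forall>x y. norm x = norm y \<longrightarrow> J x = J y)"

text \<open>
  The Bochner integral is \<open>0\<close> at points where the integrand is not integrable. For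
  \<open>J\<close> and \<open>f\<close> in weighted Lebesgue spaces with matching weights such points form a
  null set, as do those where the series defining the Green operator diverges.
\<close>

definition conv_op :: "('a::euclidean_space \<Rightarrow> real) \<Rightarrow> ('a \<Rightarrow> real) \<Rightarrow> 'a \<Rightarrow> real"
  where "conv_op J f x = (LINT y|lebesgue. J (x - y) * f y)"

definition green_op :: "('a::euclidean_space \<Rightarrow> real) \<Rightarrow> real \<Rightarrow> ('a \<Rightarrow> real) \<Rightarrow> 'a \<Rightarrow> real"
  where "green_op J t f x =
    exp (- enn2real (Lq_norm 1 J) * t) * (\<Sum>k. t ^ k / fact k * (conv_op J ^^ k) f x)"

end

theory Submission
  imports Defs
begin

text \<open>
  Put \<open>W x = (s + |x|\<^sup>2) powr (b / 2)\<close> with \<open>s = \<langle>t\<rangle>\<close>. Since \<open>J\<close> is even, first-order terms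
  cancel and \<open>|J| * W \<le> (\<alpha>\<^sub>0 + C / s) W\<close> pointwise; the same holds for \<open>1 / W\<close>. Dominating the
  Green operator by its analogue for \<open>|J|\<close>, whose factor \<open>exp (- \<alpha>\<^sub>0 t)\<close> absorbs \<open>\<alpha>\<^sub>0\<close>,
  both weights are reproduced up to the factor \<open>exp (C t / s) \<le> exp C\<close>, and Schur's test bounds
  the operator on \<open>L\<^sup>q\<close> with weight \<open>W\<close>, uniformly in \<open>t\<close>. Passing between \<open>W\<close> and
  \<open>\<langle>x\<rangle> powr b\<close> costs \<open>s powr (|b| / 2)\<close>.
\<close>

section \<open>Second-order estimates for translated weights\<close>

text \<open>The power is \<open>exp (p * ln (1 + u))\<close>. In the quadratic coefficient,
  \<open>2 * \<bar>p\<bar>\<close> pays for replacing the logarithm by \<open>u\<close>, and the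
  exponential term is the Taylor remainder of \<open>exp\<close>. The linear term is kept exact, so
  that contributions from opposite shifts can cancel.\<close>

lemma one_plus_powr_le:
  fixes u p :: real
  assumes "\<bar>u\<bar> \<le> 1/2"
  shows "(1 + u) powr p \<le> 1 + p * u + (2 * \<bar>p\<bar> + 2 * p\<^sup>2 * exp \<bar>p\<bar>) * u\<^sup>2"
proof -
  define v where "v = p * ln (1 + u)"
  have ln: "\<bar>ln (1 + u) - u\<bar> \<le> 2 * u\<^sup>2"
    by (rule abs_ln_one_plus_x_minus_x_bound) fact
  have "2 * u\<^sup>2 \<le> \<bar>u\<bar>"
    using mult_right_mono[OF assms, of "\<bar>u\<bar>"] by (simp add: power2_eq_square)
  with ln have "\<bar>ln (1 + u)\<bar> \<le> 2 * \<bar>u\<bar>" by linarith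
  then have v_le: "\<bar>v\<bar> \<le> \<bar>p\<bar> * (2 * \<bar>u\<bar>)"
    unfolding v_def abs_mult by (intro mult_left_mono) auto
  have "\<bar>p\<bar> * (2 * \<bar>u\<bar>) \<le> \<bar>p\<bar> * 1"
    using assms by (intro mult_left_mono) auto
  with v_le have v_le': "\<bar>v\<bar> \<le> \<bar>p\<bar>" by simp
  have "v\<^sup>2 \<le> (\<bar>p\<bar> * (2 * \<bar>u\<bar>))\<^sup>2"
    using v_le by (metis abs_ge_zero power2_abs power_mono)
  then have v2: "v\<^sup>2 \<le> 4 * p\<^sup>2 * u\<^sup>2" by (simp add: power_mult_distrib)
  have "v - p * u = p * (ln (1 + u) - u)" by (simp add: v_def algebra_simps)
  then have "\<bar>v - p * u\<bar> \<le> \<bar>p\<bar> * (2 * u\<^sup>2)"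
    using mult_left_mono[OF ln, of "\<bar>p\<bar>"] by (simp add: abs_mult)
  then have v1: "v \<le> p * u + 2 * \<bar>p\<bar> * u\<^sup>2" by linarith
  obtain r where r: "\<bar>r\<bar> \<le> \<bar>v\<bar>" "exp v = (\<Sum>m<2. v ^ m / fact m) + exp r / fact 2 * v\<^sup>2"
    using Maclaurin_exp_le[of v 2] by blast
  have "exp r / 2 * v\<^sup>2 \<le> exp \<bar>p\<bar> / 2 * (4 * p\<^sup>2 * u\<^sup>2)"
    using r(1) v_le' v2 by (intro mult_mono) auto
  moreover have "(1 + u) powr p = exp v"
    using assms by (auto simp: powr_def v_def)
  moreover have "exp v = 1 + v + exp r / 2 * v\<^sup>2"
    using r(2) by (simp add: numeral_2_eq_2)
  ultimately show ?thesis using v1 by (simp add: algebra_simps)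
qed

text \<open>For \<open>s = 1\<close> this is the Japanese bracket to the power \<open>2 * p\<close>.
  A larger \<open>s\<close> flattens the profile inside radius \<open>sqrt s\<close>, which is the
  source of the gain \<open>1 / s\<close> in second differences.\<close>

definition weight :: "real \<Rightarrow> real \<Rightarrow> 'a::real_normed_vector \<Rightarrow> real"
  where "weight s p x = (s + (norm x)\<^sup>2) powr p"

lemma weight_nonneg [simp]: "0 \<le> weight s p x"
  by (simp add: weight_def)

lemma weight_pos: "1 \<le> s \<Longrightarrow> 0 < weight s p x"
  unfolding weight_def using zero_le_power2[of "norm x"]
  by (metis add_nonneg_pos add.commute less_le_trans zero_less_one powr_gt_zero less_irrefl)

lemma weight_minus: "1 \<le> s \<Longrightarrow> weight s (- p) x = 1 / weight s p x"
  by (simp add: weight_def powr_minus_divide)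

lemma weight_borel_measurable [measurable]:
  "weight s p \<in> borel_measurable (borel :: 'a::euclidean_space measure)"
  unfolding weight_def by measurable

lemma japanese_bracket_ge_1: "1 \<le> japanese_bracket x"
  by (simp add: japanese_bracket_def)

lemma japanese_bracket_powr: "japanese_bracket x powr b = weight 1 (b / 2) x"
proof -
  have "0 < 1 + (norm x)\<^sup>2" by (simp add: add_pos_nonneg)
  then show ?thesis
    unfolding japanese_bracket_def weight_def by (simp add: powr_half_sqrt[symmetric] powr_powr)
qed

text \<open>A Peetre inequality whose factor does not depend on \<open>s\<close>: the bound for
  \<open>(norm (x + y))\<^sup>2\<close> is the nonnegativity of
  \<open>(norm (x - y))\<^sup>2\<close>, and \<open>1 \<le> s\<close> absorbs the remaining
  \<open>(norm y)\<^sup>2\<close>.\<close>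

lemma peetre:
  fixes x y :: "'a::real_inner"
  assumes "1 \<le> s"
  shows "s + (norm (x + y))\<^sup>2 \<le> 2 * (1 + (norm y)\<^sup>2) * (s + (norm x)\<^sup>2)"
proof -
  have "(norm (x + y))\<^sup>2 \<le> 2 * (norm x)\<^sup>2 + 2 * (norm y)\<^sup>2"
    using inner_ge_zero[of "x - y"]
    by (simp add: power2_norm_eq_inner algebra_simps inner_commute)
  moreover have "(norm y)\<^sup>2 \<le> (norm y)\<^sup>2 * s"
    using mult_left_mono[OF assms, of "(norm y)\<^sup>2"] by simp
  moreover have "0 \<le> (norm y)\<^sup>2 * (norm x)\<^sup>2" by simp
  moreover have "2 * (1 + (norm y)\<^sup>2) * (s + (norm x)\<^sup>2) =
      2 * s + 2 * (norm x)\<^sup>2 + 2 * ((norm y)\<^sup>2 * s) + 2 * ((norm y)\<^sup>2 * (norm x)\<^sup>2)"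
    by (simp add: algebra_simps)
  ultimately show ?thesis using assms by linarith
qed

lemma weight_translate_le:
  fixes x y :: "'a::real_inner"
  assumes s: "1 \<le> s"
  shows "weight s p (x + y) \<le> (2 * (1 + (norm y)\<^sup>2)) powr \<bar>p\<bar> * weight s p x"
proof -
  let ?D = "2 * (1 + (norm y)\<^sup>2)"
  have D: "0 < ?D" by (simp add: add_pos_nonneg)
  have pos: "0 < s + (norm z)\<^sup>2" for z :: 'a using s by (simp add: add_pos_nonneg)
  show ?thesis
  proof (cases "0 \<le> p")
    case True
    have "(s + (norm (x + y))\<^sup>2) powr p \<le> (?D * (s + (norm x)\<^sup>2)) powr p"
      using peetre[OF s, of x y] pos[of "x+y"] True by (intro powr_mono2) auto
    then show ?thesis using True pos[of x] D by (simp add: weight_def powr_mult)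
  next
    case False
    \<comment> \<open>For a negative exponent the inequality is needed in the other direction, so
      the shift is undone: \<open>x\<close> is \<open>x + y\<close> translated by
      \<open>- y\<close>.\<close>
    have "s + (norm x)\<^sup>2 \<le> ?D * (s + (norm (x + y))\<^sup>2)"
      using peetre[OF s, of "x + y" "- y"] by simp
    then have "(?D * (s + (norm (x + y))\<^sup>2)) powr p \<le> (s + (norm x)\<^sup>2) powr p"
      using pos[of x] False by (intro powr_mono2') auto
    then have "?D powr p * weight s p (x + y) \<le> weight s p x"
      using pos[of "x+y"] D by (simp add: weight_def powr_mult)
    then have "?D powr (-p) * (?D powr p * weight s p (x + y)) \<le> ?D powr (-p) * weight s p x"
      by (intro mult_left_mono) auto
    moreover have "?D powr (-p) * ?D powr p = 1"
      using D by (simp add: powr_add[symmetric] del: distrib_left_numeral)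
    ultimately show ?thesis using False by (simp add: mult.assoc[symmetric])
  qed
qed

text \<open>
  For small \<open>y\<close> the first-order Taylor terms cancel, leaving a gain of \<open>1 / s\<close>; for
  \<open>norm y \<ge> sqrt s / 4\<close> that factor is absorbed by two powers of \<open>norm y\<close>.
\<close>

lemma weight_second_difference:
  obtains C where "0 \<le> C" and
    "\<And>p s (x :: 'a::real_inner) y. \<bar>p\<bar> = P \<Longrightarrow> 1 \<le> s \<Longrightarrow>
      weight s p (x + y) + weight s p (x - y)
        \<le> 2 * (1 + C * weight 1 (P + 1) y / s) * weight s p x"
proof -
  \<comment> \<open>\<open>A\<close> is the quadratic coefficient of
    \<open>one_plus_powr_le\<close>. In \<open>C\<close> the first entry serves small
    \<open>y\<close>, the second large \<open>y\<close>. Both depend on the exponent only through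
    its modulus, so one constant serves a weight and its reciprocal.\<close>
  define A where "A = 2 * P + 2 * P\<^sup>2 * exp P"
  define C where "C = max (2 * (P + A)) (16 * 2 powr P)"
  have bound: "weight s p (x + y) + weight s p (x - y)
        \<le> 2 * (1 + C * weight 1 (P + 1) y / s) * weight s p x"
    if p: "\<bar>p\<bar> = P" and s: "1 \<le> s" for p s and x y :: 'a
  proof -
    have A_def: "A = 2 * \<bar>p\<bar> + 2 * p\<^sup>2 * exp \<bar>p\<bar>" and C_def: "C = max (2 * (\<bar>p\<bar> + A)) (16 * 2 powr \<bar>p\<bar>)"
      using p by (auto simp: A_def C_def)
    have A: "0 \<le> A" by (simp add: A_def)
    let ?n = "norm y"
    define a where "a = s + (norm x)\<^sup>2"
    define D where "D = 1 + ?n\<^sup>2"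
    have a: "0 < a" "s \<le> a" using s by (auto simp: a_def add_pos_nonneg)
    have D: "1 \<le> D" "?n\<^sup>2 \<le> D" by (auto simp: D_def)
    have wD: "weight 1 (P + 1) y = D powr \<bar>p\<bar> * D"
      using D by (simp add: weight_def D_def powr_add flip: p)
    have wx: "weight s p x = a powr p" by (simp add: weight_def a_def)
    have Dp: "1 \<le> D powr \<bar>p\<bar>" using D by (intro ge_one_powr_ge_zero) auto
    show ?thesis
    proof (cases "4 * ?n \<le> sqrt s")
      case True
      \<comment> \<open>The relative increments of \<open>s + (norm x)\<^sup>2\<close> under the
        shifts by \<open>y\<close> and \<open>- y\<close>. The case condition bounds both by 5/16,
        within the range of \<open>one_plus_powr_le\<close>.\<close>
      define up um where "up = (?n\<^sup>2 + 2 * (x \<bullet> y)) / a" and "um = (?n\<^sup>2 - 2 * (x \<bullet> y)) / a"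
      have "a * up = ?n\<^sup>2 + 2 * (x \<bullet> y)" "a * um = ?n\<^sup>2 - 2 * (x \<bullet> y)"
        using a by (simp_all add: up_def um_def)
      then have "s + (norm (x + y))\<^sup>2 = a * (1 + up)" "s + (norm (x - y))\<^sup>2 = a * (1 + um)"
        by (simp_all add: distrib_left) (simp_all add: a_def power2_norm_eq_inner inner_simps inner_commute)
      then have w: "weight s p (x + y) = (1 + up) powr p * a powr p"
          "weight s p (x - y) = (1 + um) powr p * a powr p"
        using a by (simp_all add: weight_def powr_mult)
      \<comment> \<open>Cauchy-Schwarz together with
        \<open>2 * (norm x * sqrt s) \<le> s + (norm x)\<^sup>2\<close>; the cross term is thus only
        of order \<open>1 / sqrt s\<close>, and its square of order \<open>1 / s\<close>.\<close>
      have xy: "\<bar>2 * (x \<bullet> y)\<bar> / a \<le> ?n / sqrt s"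
      proof -
        have "2 * (norm x * sqrt s) \<le> a"
          using zero_le_power2[of "norm x - sqrt s"] s by (simp add: a_def power2_diff)
        then have "2 * (norm x * sqrt s) * ?n \<le> a * ?n" by (rule mult_right_mono) simp
        moreover have "\<bar>x \<bullet> y\<bar> \<le> norm x * ?n" by (rule Cauchy_Schwarz_ineq2)
        then have "2 * sqrt s * \<bar>x \<bullet> y\<bar> \<le> 2 * sqrt s * (norm x * ?n)"
          using s by (intro mult_left_mono) auto
        ultimately have "\<bar>2 * (x \<bullet> y)\<bar> * sqrt s \<le> ?n * a" by (simp add: algebra_simps abs_mult)
        then show ?thesis using a s by (simp add: field_simps)
      qed
      have n: "?n / sqrt s \<le> 1/4" using True s by (simp add: field_simps)
      have sq: "(?n / sqrt s)\<^sup>2 = ?n\<^sup>2 / s" using s by (simp add: power_divide)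
      have n2: "?n\<^sup>2 / a \<le> ?n\<^sup>2 / s" using a s by (intro divide_left_mono) auto
      have n3: "?n\<^sup>2 / s \<le> 1/4 * (?n / sqrt s)"
        using mult_right_mono[OF n, of "?n / sqrt s"] s unfolding sq[symmetric] by (simp add: power2_eq_square)
      have u: "\<bar>up\<bar> \<le> 5/4 * (?n / sqrt s)" "\<bar>um\<bar> \<le> 5/4 * (?n / sqrt s)"
      proof -
        have "\<bar>?n\<^sup>2 + z\<bar> \<le> ?n\<^sup>2 + \<bar>z\<bar>" "\<bar>?n\<^sup>2 - z\<bar> \<le> ?n\<^sup>2 + \<bar>z\<bar>" for z :: real
          using zero_le_power2[of ?n] by linarith+
        then have "\<bar>up\<bar> \<le> ?n\<^sup>2 / a + \<bar>2 * (x \<bullet> y)\<bar> / a" "\<bar>um\<bar> \<le> ?n\<^sup>2 / a + \<bar>2 * (x \<bullet> y)\<bar> / a"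
          unfolding up_def um_def using a by (auto simp: add_divide_distrib[symmetric] abs_divide intro!: divide_right_mono)
        then show "\<bar>up\<bar> \<le> 5/4 * (?n / sqrt s)" "\<bar>um\<bar> \<le> 5/4 * (?n / sqrt s)"
          using n2 n3 xy by linarith+
      qed
      have uh: "\<bar>up\<bar> \<le> 1/2" "\<bar>um\<bar> \<le> 1/2" using u n by linarith+
      have u2: "up\<^sup>2 + um\<^sup>2 \<le> 4 * (?n\<^sup>2 / s)"
      proof -
        have "up\<^sup>2 \<le> (5/4 * (?n / sqrt s))\<^sup>2" "um\<^sup>2 \<le> (5/4 * (?n / sqrt s))\<^sup>2"
          using u by (metis abs_ge_zero power2_abs power_mono)+
        moreover have "(5/4 :: real)\<^sup>2 = 25/16" by (simp add: power2_eq_square)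
        moreover have "0 \<le> ?n\<^sup>2 / s" using s by simp
        ultimately show ?thesis unfolding power_mult_distrib sq \<open>(5/4 :: real)\<^sup>2 = 25/16\<close> by linarith
      qed
      define X where "X = ?n\<^sup>2 / s"
      have X: "0 \<le> X" using s by (simp add: X_def)
      \<comment> \<open>The inner products cancel here, so the linear part of the expansion is
        already of size \<open>?n\<^sup>2 / s\<close>.\<close>
      have sum: "up + um = 2 * (?n\<^sup>2 / a)" using a by (simp add: up_def um_def field_simps)
      have "(1 + up) powr p + (1 + um) powr p \<le> 2 + p * (up + um) + A * (up\<^sup>2 + um\<^sup>2)"
        using one_plus_powr_le[OF uh(1), of p] one_plus_powr_le[OF uh(2), of p]
        unfolding A_def[symmetric] by (simp add: algebra_simps)
      moreover have "p * (up + um) \<le> \<bar>p\<bar> * (2 * X)"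
        unfolding sum X_def using n2 a by (intro mult_mono) auto
      moreover have "A * (up\<^sup>2 + um\<^sup>2) \<le> A * (4 * X)"
        unfolding X_def using u2 A by (rule mult_left_mono)
      ultimately have "(1 + up) powr p + (1 + um) powr p \<le> 2 + \<bar>p\<bar> * (2 * X) + A * (4 * X)"
        by linarith
      also have "\<dots> \<le> 2 + 2 * (2 * (\<bar>p\<bar> + A) * X)"
        using mult_nonneg_nonneg[of "\<bar>p\<bar>" X] X by (simp add: algebra_simps)
      also have "2 * (\<bar>p\<bar> + A) * X \<le> C * (D powr \<bar>p\<bar> * D / s)"
        unfolding X_def
        using s A D mult_mono[OF Dp D(2)] by (intro mult_mono divide_right_mono) (auto simp: C_def)
      finally have "(1 + up) powr p + (1 + um) powr p \<le> 2 * (1 + C * (D powr \<bar>p\<bar> * D) / s)"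
        by simp
      from mult_right_mono[OF this, of "a powr p"] show ?thesis
        unfolding w wD wx by (simp add: algebra_simps)
    next
      case False
      then have "(sqrt s)\<^sup>2 \<le> (4 * ?n)\<^sup>2" using s by (intro power_mono) auto
      then have "s \<le> 16 * D" using s D by (simp add: power_mult_distrib)
      then have "1 \<le> 16 * D / s" using s by simp
      then have "(2 * D) powr \<bar>p\<bar> * 1 \<le> (2 * D) powr \<bar>p\<bar> * (16 * D / s)"
        by (intro mult_left_mono) auto
      also have "\<dots> = 16 * 2 powr \<bar>p\<bar> * (D powr \<bar>p\<bar> * D / s)"
        using D by (simp add: powr_mult)
      also have "\<dots> \<le> C * (D powr \<bar>p\<bar> * D / s)"
        using s D by (intro mult_right_mono) (auto simp: C_def)
      finally have *: "(2 * D) powr \<bar>p\<bar> \<le> C * (D powr \<bar>p\<bar> * D / s)" by simp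
      have "weight s p (x + y) \<le> (2 * D) powr \<bar>p\<bar> * weight s p x"
        "weight s p (x - y) \<le> (2 * D) powr \<bar>p\<bar> * weight s p x"
        using weight_translate_le[OF s, of p x y] weight_translate_le[OF s, of p x "- y"]
        by (simp_all add: D_def)
      then have "weight s p (x + y) + weight s p (x - y) \<le> 2 * ((2 * D) powr \<bar>p\<bar> * weight s p x)"
        by simp
      also have "\<dots> \<le> 2 * ((1 + C * (D powr \<bar>p\<bar> * D / s)) * weight s p x)"
        using * by (intro mult_left_mono mult_right_mono) auto
      finally show ?thesis unfolding wD by (simp add: mult.assoc del: distrib_left_numeral)
    qed
  qed
  have "0 \<le> C" by (simp add: C_def le_max_iff_disj)
  show ?thesis by (rule that[OF \<open>0 \<le> C\<close> bound])
qed

section \<open>Positive convolution and Green operators\<close>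

text \<open>Values in \<open>ennreal\<close> remove every question of integrability and convergence,
  and Borel functions over \<open>lborel\<close> make Tonelli available. \<open>K\<close> stands for
  a Borel version of the modulus of \<open>J\<close>.\<close>

definition pconv :: "('a::euclidean_space \<Rightarrow> ennreal) \<Rightarrow> ('a \<Rightarrow> ennreal) \<Rightarrow> 'a \<Rightarrow> ennreal"
  where "pconv K F x = (\<integral>\<^sup>+y. K (x - y) * F y \<partial>lborel)"

definition pgreen ::
    "('a::euclidean_space \<Rightarrow> ennreal) \<Rightarrow> real \<Rightarrow> real \<Rightarrow> ('a \<Rightarrow> ennreal) \<Rightarrow> 'a \<Rightarrow> ennreal"
  where "pgreen K a t F x = ennreal (exp (- a * t)) * (\<Sum>k. ennreal (t ^ k / fact k) * (pconv K ^^ k) F x)"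

lemma nn_integral_lborel_reflect:
  fixes g :: "'a::euclidean_space \<Rightarrow> ennreal"
  assumes [measurable]: "g \<in> borel_measurable borel"
  shows "(\<integral>\<^sup>+y. g (x - y) \<partial>lborel) = (\<integral>\<^sup>+y. g y \<partial>lborel)"
proof -
  have "(\<integral>\<^sup>+y. g y \<partial>lborel) = (\<integral>\<^sup>+y. g y \<partial>distr lborel borel (\<lambda>y. x + (-1) *\<^sub>R y))"
    by (subst lborel_affine[of "-1" x]) (simp_all add: density_1)
  also have "\<dots> = (\<integral>\<^sup>+y. g (x - y) \<partial>lborel)"
    by (subst nn_integral_distr) simp_all
  finally show ?thesis by simp
qed

text \<open>The exceptional set lies in a Borel null set, and reflection preserves the integral of
  its indicator. This carries almost-everywhere facts about a kernel to the argument
  \<open>x - y\<close> for each fixed \<open>x\<close>.\<close>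

lemma AE_lborel_reflect:
  fixes x :: "'a::euclidean_space"
  assumes "AE y in lborel. P y"
  shows "AE y in lborel. P (x - y)"
proof -
  obtain N where N: "{y. \<not> P y} \<subseteq> N" "N \<in> sets lborel" "emeasure lborel N = 0"
    using AE_E[OF assms] by (auto simp: space_lborel)
  have [measurable]: "N \<in> sets borel" using N(2) by simp
  have "(\<integral>\<^sup>+y. indicator N (x - y) \<partial>lborel) = (\<integral>\<^sup>+y. indicator N y \<partial>lborel)"
    by (rule nn_integral_lborel_reflect) measurable
  also have "\<dots> = 0" using N by simp
  finally have "AE y in lborel. indicator N (x - y) = (0 :: ennreal)"
    by (subst (asm) nn_integral_0_iff_AE) auto
  then show ?thesis by eventually_elim (use N(1) in \<open>auto simp: indicator_def split: if_splits\<close>)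
qed

lemma pconv_borel_measurable [measurable]:
  assumes [measurable]: "K \<in> borel_measurable borel" "F \<in> borel_measurable borel"
  shows "pconv K F \<in> borel_measurable borel"
  unfolding pconv_def by measurable

lemma pconv_iter_borel_measurable [measurable]:
  assumes [measurable]: "K \<in> borel_measurable borel" "F \<in> borel_measurable borel"
  shows "(pconv K ^^ k) F \<in> borel_measurable borel"
  by (induction k) simp_all

lemma pgreen_borel_measurable [measurable]:
  assumes [measurable]: "K \<in> borel_measurable borel" "F \<in> borel_measurable borel"
  shows "pgreen K a t F \<in> borel_measurable borel"
  unfolding pgreen_def by measurable

text \<open>Positivity of the kernel lets the bound pass through each convolution, and every pass
  costs one factor \<open>\<kappa>\<close> on the \<open>V\<close> term. The \<open>G\<close> term
  is left as an iterate, to be summed or integrated later.\<close>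

lemma pconv_iter_le:
  assumes [measurable]: "K \<in> borel_measurable borel" "G \<in> borel_measurable borel" "V \<in> borel_measurable borel"
    and V: "\<And>x. pconv K V x \<le> \<kappa> * V x"
    and F: "\<And>x. F x \<le> a * G x + c * V x"
  shows "(pconv K ^^ k) F x \<le> a * (pconv K ^^ k) G x + c * \<kappa> ^ k * V x"
proof (induction k arbitrary: x)
  case (Suc k)
  have "K (x - y) * (pconv K ^^ k) F y \<le> K (x - y) * (a * (pconv K ^^ k) G y + c * \<kappa> ^ k * V y)" for y
    by (rule mult_left_mono[OF Suc]) simp
  then have "(pconv K ^^ Suc k) F x \<le> (\<integral>\<^sup>+y. a * (K (x - y) * (pconv K ^^ k) G y) + c * \<kappa> ^ k * (K (x - y) * V y) \<partial>lborel)"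
    unfolding funpow.simps o_apply pconv_def[where F = "(_ ^^ _) F"]
    by (intro nn_integral_mono) (simp add: algebra_simps)
  also have "\<dots> = a * pconv K ((pconv K ^^ k) G) x + c * \<kappa> ^ k * pconv K V x"
    unfolding pconv_def[where F = "(_ ^^ _) G"] pconv_def[where F = V]
    by (simp add: nn_integral_add nn_integral_cmult)
  also have "\<dots> \<le> a * pconv K ((pconv K ^^ k) G) x + c * \<kappa> ^ k * (\<kappa> * V x)"
    by (intro add_left_mono mult_left_mono V) simp
  finally show ?case by (simp add: ac_simps)
qed (use F in simp)

lemma exp_suminf_ennreal:
  assumes "0 \<le> t" "0 \<le> \<kappa>"
  shows "(\<Sum>k. ennreal (t ^ k / fact k) * ennreal \<kappa> ^ k) = ennreal (exp (\<kappa> * t))"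
proof -
  have "(\<lambda>k. t ^ k / fact k * \<kappa> ^ k) sums exp (\<kappa> * t)"
    using exp_converges[of "\<kappa> * t"] by (simp add: power_mult_distrib scaleR_conv_of_real field_simps)
  then show ?thesis
    using assms by (simp add: ennreal_power ennreal_mult'[symmetric] suminf_ennreal2 sums_iff)
qed

text \<open>Summing the iterate bounds against \<open>t ^ k / fact k\<close> turns
  \<open>\<kappa> ^ k\<close> into an exponential, so only the excess of \<open>\<kappa>\<close>
  over \<open>\<alpha>\<close> drives growth. With \<open>a = 0\<close> this gives the supremum
  bound; with a Young splitting of \<open>F\<close> it gives the pointwise Schur estimate.\<close>

lemma pgreen_le:
  assumes "K \<in> borel_measurable borel" "G \<in> borel_measurable borel" "V \<in> borel_measurable borel"
    and "\<And>x. pconv K V x \<le> ennreal \<kappa> * V x"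
    and "\<And>x. F x \<le> a * G x + c * V x"
    and t: "0 \<le> t" "0 \<le> \<kappa>"
  shows "pgreen K \<alpha> t F x \<le> a * pgreen K \<alpha> t G x + c * ennreal (exp ((\<kappa> - \<alpha>) * t)) * V x"
proof -
  let ?e = "ennreal (exp (- \<alpha> * t))" and ?w = "\<lambda>k. ennreal (t ^ k / fact k)"
  have "pgreen K \<alpha> t F x \<le> ?e * (\<Sum>k. ?w k * (a * (pconv K ^^ k) G x + c * ennreal \<kappa> ^ k * V x))"
    unfolding pgreen_def by (intro mult_left_mono suminf_le pconv_iter_le assms) auto
  also have "(\<Sum>k. ?w k * (a * (pconv K ^^ k) G x + c * ennreal \<kappa> ^ k * V x)) =
      a * (\<Sum>k. ?w k * (pconv K ^^ k) G x) + (c * V x) * (\<Sum>k. ?w k * ennreal \<kappa> ^ k)"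
    unfolding ennreal_suminf_cmult[symmetric]
    by (subst suminf_add) (auto simp: algebra_simps)
  also have "?e * \<dots> = a * pgreen K \<alpha> t G x + c * (?e * ennreal (exp (\<kappa> * t))) * V x"
    unfolding exp_suminf_ennreal[OF t] pgreen_def by (simp add: algebra_simps)
  also have "?e * ennreal (exp (\<kappa> * t)) = ennreal (exp ((\<kappa> - \<alpha>) * t))"
    by (simp add: ennreal_mult'[symmetric] exp_add[symmetric] algebra_simps)
  finally show ?thesis .
qed

text \<open>Tonelli moves the kernel from \<open>F\<close> onto \<open>W\<close>; hence the
  hypothesis integrates over the first variable of \<open>K (x - y)\<close> and concerns the
  transposed convolution.\<close>

lemma nn_integral_pconv_le:
  assumes [measurable]: "K \<in> borel_measurable borel" "F \<in> borel_measurable borel" "W \<in> borel_measurable borel"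
    and W: "\<And>y. (\<integral>\<^sup>+x. K (x - y) * W x \<partial>lborel) \<le> \<kappa> * W y"
  shows "(\<integral>\<^sup>+x. W x * pconv K F x \<partial>lborel) \<le> \<kappa> * (\<integral>\<^sup>+x. W x * F x \<partial>lborel)"
proof -
  have "(\<integral>\<^sup>+x. W x * pconv K F x \<partial>lborel) = (\<integral>\<^sup>+x. \<integral>\<^sup>+y. W x * (K (x - y) * F y) \<partial>lborel \<partial>lborel)"
    unfolding pconv_def by (simp add: nn_integral_cmult)
  also have "\<dots> = (\<integral>\<^sup>+y. \<integral>\<^sup>+x. W x * (K (x - y) * F y) \<partial>lborel \<partial>lborel)"
    by (rule lborel_pair.Fubini') simp
  also have "\<dots> = (\<integral>\<^sup>+y. F y * (\<integral>\<^sup>+x. K (x - y) * W x \<partial>lborel) \<partial>lborel)"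
    by (subst nn_integral_cmult[symmetric]) (auto simp: algebra_simps)
  also have "\<dots> \<le> (\<integral>\<^sup>+y. F y * (\<kappa> * W y) \<partial>lborel)"
    by (intro nn_integral_mono mult_left_mono W) simp
  also have "\<dots> = (\<integral>\<^sup>+y. \<kappa> * (W y * F y) \<partial>lborel)" by (simp add: ac_simps)
  also have "\<dots> = \<kappa> * (\<integral>\<^sup>+x. W x * F x \<partial>lborel)" by (simp add: nn_integral_cmult)
  finally show ?thesis .
qed

lemma nn_integral_pconv_iter_le:
  assumes [measurable]: "K \<in> borel_measurable borel" "F \<in> borel_measurable borel" "W \<in> borel_measurable borel"
    and W: "\<And>y. (\<integral>\<^sup>+x. K (x - y) * W x \<partial>lborel) \<le> \<kappa> * W y"
  shows "(\<integral>\<^sup>+x. W x * (pconv K ^^ k) F x \<partial>lborel) \<le> \<kappa> ^ k * (\<integral>\<^sup>+x. W x * F x \<partial>lborel)"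
proof (induction k)
  case (Suc k)
  have "(\<integral>\<^sup>+x. W x * (pconv K ^^ Suc k) F x \<partial>lborel) \<le> \<kappa> * (\<integral>\<^sup>+x. W x * (pconv K ^^ k) F x \<partial>lborel)"
    using W by (simp add: nn_integral_pconv_le)
  also have "\<dots> \<le> \<kappa> * (\<kappa> ^ k * (\<integral>\<^sup>+x. W x * F x \<partial>lborel))"
    by (intro mult_left_mono Suc) simp
  finally show ?case by (simp add: ac_simps)
qed simp

text \<open>The dual counterpart of \<open>pgreen_le\<close>: monotone convergence exchanges sum and
  integral, and each iterate contributes \<open>\<kappa> ^ k\<close>.\<close>

lemma nn_integral_pgreen_le:
  assumes [measurable]: "K \<in> borel_measurable borel" "F \<in> borel_measurable borel" "W \<in> borel_measurable borel"
    and W: "\<And>y. (\<integral>\<^sup>+x. K (x - y) * W x \<partial>lborel) \<le> ennreal \<kappa> * W y"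
    and t: "0 \<le> t" "0 \<le> \<kappa>"
  shows "(\<integral>\<^sup>+x. W x * pgreen K \<alpha> t F x \<partial>lborel)
    \<le> ennreal (exp ((\<kappa> - \<alpha>) * t)) * (\<integral>\<^sup>+x. W x * F x \<partial>lborel)"
proof -
  let ?e = "ennreal (exp (- \<alpha> * t))" and ?w = "\<lambda>k. ennreal (t ^ k / fact k)"
  let ?I = "\<integral>\<^sup>+x. W x * F x \<partial>lborel"
  have "(\<integral>\<^sup>+x. W x * pgreen K \<alpha> t F x \<partial>lborel) =
      (\<integral>\<^sup>+x. ?e * (\<Sum>k. ?w k * (W x * (pconv K ^^ k) F x)) \<partial>lborel)"
    unfolding pgreen_def
    by (intro nn_integral_cong) (simp add: ennreal_suminf_cmult[symmetric] ac_simps del: ennreal_suminf_cmult)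
  also have "\<dots> = ?e * (\<Sum>k. ?w k * (\<integral>\<^sup>+x. W x * (pconv K ^^ k) F x \<partial>lborel))"
    by (simp add: nn_integral_cmult nn_integral_suminf)
  also have "\<dots> \<le> ?e * (\<Sum>k. ?w k * (ennreal \<kappa> ^ k * ?I))"
    by (intro mult_left_mono suminf_le nn_integral_pconv_iter_le assms) auto
  also have "(\<Sum>k. ?w k * (ennreal \<kappa> ^ k * ?I)) = (\<Sum>k. ?w k * ennreal \<kappa> ^ k) * ?I"
    unfolding ennreal_suminf_multc[symmetric] by (simp add: ac_simps)
  also have "?e * \<dots> = ?e * ennreal (exp (\<kappa> * t)) * ?I"
    unfolding exp_suminf_ennreal[OF t] by (simp add: ac_simps)
  also have "?e * ennreal (exp (\<kappa> * t)) = ennreal (exp ((\<kappa> - \<alpha>) * t))"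
    by (simp add: ennreal_mult'[symmetric] exp_add[symmetric] algebra_simps)
  finally show ?thesis .
qed

section \<open>Convolution almost reproduces the weights\<close>

text \<open>Evenness lets the convolution be averaged over \<open>z\<close> and \<open>- z\<close>,
  so that the second-difference bound applies under the integral. Its constant part gives
  \<open>\<alpha>\<close>; its \<open>1 / s\<close> part gives the moment \<open>m\<close>, of order
  \<open>2 * \<bar>p\<bar> + 2\<close>.\<close>

lemma pconv_weight_le:
  fixes K :: "'a::euclidean_space \<Rightarrow> ennreal"
  assumes K [measurable]: "K \<in> borel_measurable borel" and even: "AE y in lborel. K (- y) = K y"
    and s: "1 \<le> s" and nonneg: "0 \<le> \<alpha>" "0 \<le> m" "0 \<le> C"
    and \<alpha>: "(\<integral>\<^sup>+y. K y \<partial>lborel) \<le> ennreal \<alpha>"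
    and m: "(\<integral>\<^sup>+y. K y * ennreal (weight 1 (\<bar>p\<bar> + 1) y) \<partial>lborel) \<le> ennreal m"
    and C: "\<And>s x y :: 'a. 1 \<le> s \<Longrightarrow> weight s p (x + y) + weight s p (x - y)
        \<le> 2 * (1 + C * weight 1 (\<bar>p\<bar> + 1) y / s) * weight s p x"
  shows "pconv K (\<lambda>x. ennreal (weight s p x)) x \<le> ennreal (\<alpha> + C * m / s) * ennreal (weight s p x)"
proof -
  let ?w = "\<lambda>x::'a. ennreal (weight s p x)" and ?q = "\<lambda>y::'a. ennreal (weight 1 (\<bar>p\<bar> + 1) y)"
  have minus: "pconv K ?w x = (\<integral>\<^sup>+z. K z * ?w (x - z) \<partial>lborel)"
    using nn_integral_lborel_reflect[of "\<lambda>z. K z * ?w (x - z)" x] by (simp add: pconv_def)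
  also have "\<dots> = (\<integral>\<^sup>+z. K (- z) * ?w (x + z) \<partial>lborel)"
    using nn_integral_lborel_reflect[of "\<lambda>z. K z * ?w (x - z)" 0] by simp
  also have "\<dots> = (\<integral>\<^sup>+z. K z * ?w (x + z) \<partial>lborel)"
    by (rule nn_integral_cong_AE) (use even in eventually_elim, simp)
  finally have "2 * pconv K ?w x = (\<integral>\<^sup>+z. K z * ?w (x + z) \<partial>lborel) + (\<integral>\<^sup>+z. K z * ?w (x - z) \<partial>lborel)"
    using minus by (metis mult_2)
  also have "\<dots> = (\<integral>\<^sup>+z. K z * (?w (x + z) + ?w (x - z)) \<partial>lborel)"
    by (simp add: nn_integral_add distrib_left)
  also have "\<dots> \<le> (\<integral>\<^sup>+z. K z * (2 * (1 + ennreal (C / s) * ?q z) * ?w x) \<partial>lborel)"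
  proof (intro nn_integral_mono mult_left_mono)
    fix z
    have "?w (x + z) + ?w (x - z) = ennreal (weight s p (x + z) + weight s p (x - z))"
      by simp
    also have "\<dots> \<le> ennreal (2 * (1 + C / s * weight 1 (\<bar>p\<bar> + 1) z) * weight s p x)"
      using C[OF s] by (intro ennreal_leI) simp
    also have "\<dots> = 2 * (1 + ennreal (C / s) * ?q z) * ?w x"
      using nonneg s by (simp add: ennreal_mult del: distrib_left_numeral times_divide_eq_left)
    finally show "?w (x + z) + ?w (x - z) \<le> 2 * (1 + ennreal (C / s) * ?q z) * ?w x" .
  qed simp
  also have "\<dots> = (\<integral>\<^sup>+z. 2 * ?w x * (K z + ennreal (C / s) * (K z * ?q z)) \<partial>lborel)"
    by (simp add: algebra_simps)
  also have "\<dots> = 2 * ?w x * ((\<integral>\<^sup>+z. K z \<partial>lborel) + ennreal (C / s) * (\<integral>\<^sup>+z. K z * ?q z \<partial>lborel))"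
    by (simp add: nn_integral_cmult nn_integral_add)
  also have "\<dots> \<le> 2 * ?w x * (ennreal \<alpha> + ennreal (C / s) * ennreal m)"
    by (intro mult_left_mono add_mono \<alpha> m) auto
  also have "\<dots> = 2 * (ennreal (\<alpha> + C * m / s) * ?w x)"
    using nonneg s by (simp add: ennreal_mult'[symmetric] ennreal_plus ac_simps)
  finally show ?thesis
    by (subst (asm) ennreal_mult_le_mult_iff) auto
qed

text \<open>For an even kernel the transposed convolution is the convolution itself, so
  \<open>pconv_weight_le\<close> supplies both conditions of the Schur test.\<close>

lemma nn_integral_even_kernel:
  fixes K :: "'a::euclidean_space \<Rightarrow> ennreal"
  assumes "AE y in lborel. K (- y) = K y"
  shows "(\<integral>\<^sup>+x. K (x - y) * W x \<partial>lborel) = pconv K W y"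
  unfolding pconv_def
  by (rule nn_integral_cong_AE) (use AE_lborel_reflect[OF assms, of y] in \<open>eventually_elim, simp\<close>)

section \<open>Weighted Schur test\<close>

text \<open>Weighted AM-GM for \<open>l powr (1 - r) * a powr r\<close> and \<open>l\<close>: in
  their geometric mean the powers of \<open>l\<close> cancel and leave \<open>a\<close>. The free
  scale \<open>l\<close> allows later optimisation; \<open>l = a\<close> gives equality for positive
  \<open>a\<close>.\<close>

lemma young_scaled:
  fixes a l r :: real
  assumes "0 \<le> a" "0 < l" "1 \<le> r"
  shows "a \<le> 1 / r * l powr (1 - r) * a powr r + (1 - 1 / r) * l"
proof (cases "a = 0")
  case False
  then have a: "0 < a" using assms by simp
  have "(l powr (1 - r) * a powr r) powr (1 / r) * l powr (1 - 1 / r)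
      \<le> 1 / r * (l powr (1 - r) * a powr r) + (1 - 1 / r) * l"
    using assms a by (intro Youngs_inequality_0) auto
  moreover have "(l powr (1 - r) * a powr r) powr (1 / r) * l powr (1 - 1 / r) = a"
  proof -
    have "(l powr (1 - r) * a powr r) powr (1 / r) * l powr (1 - 1 / r)
        = l powr ((1 - r) / r + (1 - 1 / r)) * a"
      using assms a by (simp add: powr_mult powr_powr powr_add)
    also have "(1 - r) / r + (1 - 1 / r) = 0" using assms by (simp add: field_simps)
    finally show ?thesis using assms by simp
  qed
  ultimately show ?thesis by simp
qed (use assms in auto)

text \<open>
  Young's inequality, with its scale optimised separately at each point, stands in for the Holder
  inequality of the positive operator \<open>pgreen\<close>, so no integral kernel is needed.
\<close>

lemma schur_test_pointwise:
  fixes K :: "'a::euclidean_space \<Rightarrow> ennreal" and \<phi> W :: "'a \<Rightarrow> real"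
  assumes [measurable]: "K \<in> borel_measurable borel" "\<phi> \<in> borel_measurable borel" "W \<in> borel_measurable borel"
    and W: "\<And>x. 0 < W x" and \<phi>: "\<And>x. 0 \<le> \<phi> x"
    and V: "\<And>x. pconv K (\<lambda>x. ennreal (1 / W x)) x \<le> ennreal \<kappa> * ennreal (1 / W x)"
    and t: "0 \<le> t" "0 \<le> \<kappa>" and r: "1 \<le> r"
    and M: "M = exp ((\<kappa> - \<alpha>) * t)"
    and u: "ennreal u \<le> pgreen K \<alpha> t (\<lambda>x. ennreal (\<phi> x)) x" "0 \<le> u"
  shows "ennreal ((W x * u) powr r)
    \<le> ennreal (M powr (r - 1)) * (ennreal (W x) * pgreen K \<alpha> t (\<lambda>x. ennreal ((W x * \<phi> x) powr r / W x)) x)"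
    (is "_ \<le> _ * (_ * ?P)")
proof (cases "?P = top \<or> u = 0")
  \<comment> \<open>Either the right-hand side is infinite or the left-hand side is zero. Otherwise
    \<open>z\<close> below is positive, as the choice of \<open>l\<close> requires.\<close>
  case True
  then show ?thesis using W[of x] r by (auto simp: M ennreal_mult_top ennreal_top_mult)
next
  case False
  then obtain v where v: "?P = ennreal v" "0 \<le> v"
    by (metis ennreal_cases)
  have M0: "0 < M" by (simp add: M)
  have u0: "0 < u" using False u by simp
  define z where "z = W x * u"
  \<comment> \<open>This scale makes \<open>l * M\<close> equal to \<open>z\<close>, so the second
    Young term becomes \<open>(1 - 1 / r) * z\<close>. Absorbing it on the left leaves
    \<open>z / r\<close>.\<close>
  define l where "l = z / M"
  have z: "0 < z" using W[of x] u0 by (simp add: z_def)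
  have l: "0 < l" using z M0 by (simp add: l_def)
  \<comment> \<open>Young's inequality is applied at every \<open>y\<close> with the same
    \<open>l\<close>, fixed by the value at \<open>x\<close>; \<open>pgreen_le\<close> then
    propagates the splitting, with \<open>1 / W\<close> in the role of \<open>V\<close>.\<close>
  have "ennreal u \<le> ennreal (1 / r * l powr (1 - r)) * ?P + ennreal ((1 - 1 / r) * l) * ennreal M * ennreal (1 / W x)"
    unfolding M
  proof (rule order_trans[OF u(1) pgreen_le[OF _ _ _ V _ t]])
    fix y
    have Wy: "W y \<noteq> 0" using W[of y] by simp
    have "W y * \<phi> y \<le> 1 / r * l powr (1 - r) * (W y * \<phi> y) powr r + (1 - 1 / r) * l"
      using W[of y] \<phi>[of y] l r by (intro young_scaled) auto
    then have "W y * \<phi> y / W y \<le> (1 / r * l powr (1 - r) * (W y * \<phi> y) powr r + (1 - 1 / r) * l) / W y"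
      using W[of y] by (intro divide_right_mono) auto
    then have "\<phi> y \<le> 1 / r * l powr (1 - r) * ((W y * \<phi> y) powr r / W y) + (1 - 1 / r) * l * (1 / W y)"
      using Wy by (simp add: add_divide_distrib)
    then have "ennreal (\<phi> y) \<le> ennreal (1 / r * l powr (1 - r) * ((W y * \<phi> y) powr r / W y) + (1 - 1 / r) * l * (1 / W y))"
      by (rule ennreal_leI)
    also have "\<dots> = ennreal (1 / r * l powr (1 - r)) * ennreal ((W y * \<phi> y) powr r / W y) + ennreal ((1 - 1 / r) * l) * ennreal (1 / W y)"
      using W[of y] r l by (subst ennreal_plus) (auto simp: ennreal_mult[symmetric] less_imp_le)
    finally show "ennreal (\<phi> y) \<le> \<dots>" .
  qed measurable
  also have "\<dots> = ennreal (1 / r * l powr (1 - r) * v + (1 - 1 / r) * l * M * (1 / W x))"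
    unfolding v(1) using v(2) W[of x] r l M0 by (subst ennreal_plus) (auto simp: ennreal_mult[symmetric] less_imp_le)
  finally have "u \<le> 1 / r * l powr (1 - r) * v + (1 - 1 / r) * l * M * (1 / W x)"
    using v W[of x] r l M0 by (subst (asm) ennreal_le_iff) (auto intro!: add_nonneg_nonneg mult_nonneg_nonneg)
  then have "W x * u \<le> W x * (1 / r * l powr (1 - r) * v + (1 - 1 / r) * l * M * (1 / W x))"
    using W[of x] by (intro mult_left_mono) auto
  also have "\<dots> = 1 / r * l powr (1 - r) * (W x * v) + (1 - 1 / r) * z"
    using W[of x] M0 by (simp add: l_def distrib_left)
  finally have "z / r \<le> l powr (1 - r) * (W x * v) / r"
    unfolding z_def[symmetric] by (simp add: algebra_simps)
  then have "z \<le> l powr (1 - r) * (W x * v)" using r by (simp add: divide_le_cancel)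
  \<comment> \<open>Multiplication by this power cancels the dependence of \<open>l\<close> on
    \<open>z\<close>, leaving \<open>M powr (r - 1)\<close>.\<close>
  then have "z powr (r - 1) * z \<le> z powr (r - 1) * (l powr (1 - r) * (W x * v))"
    by (intro mult_left_mono) auto
  moreover have "z powr (r - 1) * z = z powr r" using z by (simp add: powr_diff)
  moreover have "z powr (r - 1) * l powr (1 - r) = M powr (r - 1)"
    using z M0 by (simp add: l_def powr_divide powr_diff)
  ultimately have "z powr r \<le> M powr (r - 1) * (W x * v)"
    by (simp add: mult.assoc[symmetric])
  then show ?thesis
    unfolding v(1) z_def[symmetric] using W[of x] v(2)
    by (simp add: ennreal_mult[symmetric] less_imp_le ennreal_leI)
qed

text \<open>The pointwise estimate, which uses \<open>1 / W\<close>, contributes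
  \<open>r - 1\<close> powers of the exponential factor; integrating it against \<open>W\<close> by
  the dual bound contributes the last one.\<close>

lemma schur_test:
  fixes K :: "'a::euclidean_space \<Rightarrow> ennreal" and \<phi> W u :: "'a \<Rightarrow> real"
  assumes [measurable]: "K \<in> borel_measurable borel" "\<phi> \<in> borel_measurable borel" "W \<in> borel_measurable borel"
    and W: "\<And>x. 0 < W x" and \<phi>: "\<And>x. 0 \<le> \<phi> x"
    and V: "\<And>x. pconv K (\<lambda>x. ennreal (1 / W x)) x \<le> ennreal \<kappa> * ennreal (1 / W x)"
    and V': "\<And>y. (\<integral>\<^sup>+x. K (x - y) * ennreal (W x) \<partial>lborel) \<le> ennreal \<kappa> * ennreal (W y)"
    and t: "0 \<le> t" "0 \<le> \<kappa>" and r: "1 \<le> r"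
    and u: "AE x in lborel. ennreal (u x) \<le> pgreen K \<alpha> t (\<lambda>x. ennreal (\<phi> x)) x" "\<And>x. 0 \<le> u x"
  shows "(\<integral>\<^sup>+x. ennreal ((W x * u x) powr r) \<partial>lborel)
    \<le> ennreal (exp ((\<kappa> - \<alpha>) * t) powr r) * (\<integral>\<^sup>+x. ennreal ((W x * \<phi> x) powr r) \<partial>lborel)"
proof -
  let ?M = "exp ((\<kappa> - \<alpha>) * t)"
  let ?G = "\<lambda>x. ennreal ((W x * \<phi> x) powr r / W x)"
  have "(\<integral>\<^sup>+x. ennreal ((W x * u x) powr r) \<partial>lborel)
      \<le> (\<integral>\<^sup>+x. ennreal (?M powr (r - 1)) * (ennreal (W x) * pgreen K \<alpha> t ?G x) \<partial>lborel)"
    by (rule nn_integral_mono_AE, use u(1) in eventually_elim)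
      (rule schur_test_pointwise[where \<kappa> = \<kappa>]; use W \<phi> V t r u(2) in simp)
  also have "\<dots> = ennreal (?M powr (r - 1)) * (\<integral>\<^sup>+x. ennreal (W x) * pgreen K \<alpha> t ?G x \<partial>lborel)"
    by (simp add: nn_integral_cmult)
  also have "\<dots> \<le> ennreal (?M powr (r - 1)) * (ennreal ?M * (\<integral>\<^sup>+x. ennreal (W x) * ?G x \<partial>lborel))"
    by (intro mult_left_mono nn_integral_pgreen_le V' t) auto
  also have "\<dots> = ennreal (?M powr (r - 1) * ?M) * (\<integral>\<^sup>+x. ennreal (W x) * ?G x \<partial>lborel)"
    by (simp add: ennreal_mult mult.assoc)
  also have "?M powr (r - 1) * ?M = ?M powr r" by (simp add: powr_diff)
  also have "(\<lambda>x. ennreal (W x) * ?G x) = (\<lambda>x. ennreal ((W x * \<phi> x) powr r))"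
    using W by (auto simp: fun_eq_iff ennreal_mult'[symmetric] less_imp_le less_imp_neq[symmetric])
  finally show ?thesis .
qed

section \<open>Measurability and domination of the signed operators\<close>

text \<open>Changing \<open>J\<close> and \<open>f\<close> on null sets alters the integrand only on
  a null set for each fixed \<open>x\<close>. The formula thus holds at every point, and Borel
  measurability of the convolution can be read off from it.\<close>

lemma conv_op_eq_lborel:
  fixes J J' f f' :: "'a::euclidean_space \<Rightarrow> real"
  assumes [measurable]: "J' \<in> borel_measurable borel" "f' \<in> borel_measurable borel"
    and J: "AE y in lborel. J y = J' y" and f: "AE y in lborel. f y = f' y"
  shows "conv_op J f x = (LINT y|lborel. J' (x - y) * f' y)"
proof -
  have ae: "AE y in lebesgue. J' (x - y) * f' y = J (x - y) * f y"
    unfolding AE_completion_iff using AE_lborel_reflect[OF J, of x] f by eventually_elim simp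
  have [measurable]: "(\<lambda>y. J' (x - y) * f' y) \<in> borel_measurable lebesgue"
    by (rule measurable_completion) simp
  have "conv_op J f x = (LINT y|lebesgue. J' (x - y) * f' y)"
    unfolding conv_op_def
    by (rule integral_cong_AE[OF borel_measurable_AE[OF _ ae]]) (use ae in \<open>auto simp: eq_commute\<close>)
  then show ?thesis by (simp add: integral_completion)
qed

lemma conv_op_borel_measurable:
  fixes J f :: "'a::euclidean_space \<Rightarrow> real"
  assumes "J \<in> borel_measurable lebesgue" "f \<in> borel_measurable lebesgue"
  shows "conv_op J f \<in> borel_measurable borel"
proof -
  obtain J' f' :: "'a \<Rightarrow> real" where [measurable]: "J' \<in> borel_measurable borel" "f' \<in> borel_measurable borel"
    and ae: "AE y in lborel. J y = J' y" "AE y in lborel. f y = f' y"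
    using completion_ex_borel_measurable_real[OF assms(1)] completion_ex_borel_measurable_real[OF assms(2)]
    by auto
  have "conv_op J f = (\<lambda>x. LINT y|lborel. J' (x - y) * f' y)"
    by (rule ext) (rule conv_op_eq_lborel; fact)
  then show ?thesis by simp
qed

lemma green_op_lebesgue_measurable:
  fixes J f :: "'a::euclidean_space \<Rightarrow> real"
  assumes J: "J \<in> borel_measurable lebesgue" and f: "f \<in> borel_measurable lebesgue"
  shows "green_op J t f \<in> borel_measurable lebesgue"
proof -
  have [measurable]: "(conv_op J ^^ k) f \<in> borel_measurable lebesgue" for k
  proof (induction k)
    case (Suc k)
    have "conv_op J ((conv_op J ^^ k) f) \<in> borel_measurable lborel"
      using conv_op_borel_measurable[OF J Suc] by simp
    then show ?case by (simp add: measurable_completion)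
  qed (simp add: f)
  show ?thesis unfolding green_op_def by measurable
qed

text \<open>Where the integrand is integrable this is the triangle inequality; elsewhere the Bochner
  integral has the default value 0 and the bound is trivial.\<close>

lemma conv_op_le_pconv:
  assumes K: "AE y in lborel. ennreal \<bar>J y\<bar> = K y" and g: "AE y in lborel. ennreal \<bar>g y\<bar> \<le> F y"
  shows "ennreal \<bar>conv_op J g x\<bar> \<le> pconv K F x"
proof (cases "integrable lebesgue (\<lambda>y. J (x - y) * g y)")
  case True
  have "ennreal \<bar>conv_op J g x\<bar> \<le> (\<integral>\<^sup>+y. ennreal \<bar>J (x - y) * g y\<bar> \<partial>lebesgue)"
    using integral_norm_bound_ennreal[OF True] by (simp add: conv_op_def)
  also have "\<dots> = (\<integral>\<^sup>+y. ennreal \<bar>J (x - y) * g y\<bar> \<partial>lborel)"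
    by (rule nn_integral_completion)
  also have "\<dots> \<le> pconv K F x"
    unfolding pconv_def
    by (rule nn_integral_mono_AE)
      (use AE_lborel_reflect[OF K, of x] g in \<open>eventually_elim, auto simp: abs_mult ennreal_mult intro!: mult_mono\<close>)
  finally show ?thesis .
qed (simp add: conv_op_def not_integrable_integral_eq)

text \<open>A finite right-hand side forces absolute summability. If it is infinite, the value that
  \<open>suminf\<close> assigns to the real series does not matter.\<close>

lemma ennreal_abs_suminf_le:
  fixes a :: "nat \<Rightarrow> real"
  shows "ennreal \<bar>\<Sum>k. a k\<bar> \<le> (\<Sum>k. ennreal \<bar>a k\<bar>)"
proof (cases "(\<Sum>k. ennreal \<bar>a k\<bar>) = top")
  case False
  then have *: "summable (\<lambda>k. \<bar>a k\<bar>)"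
    by (intro summable_suminf_not_top) auto
  then show ?thesis
    using summable_rabs[OF *] by (simp add: suminf_ennreal2 ennreal_leI)
qed simp

text \<open>Countably many null sets are discarded at once, after which the series are compared term
  by term.\<close>

lemma green_op_le_pgreen:
  assumes K: "AE y in lborel. ennreal \<bar>J y\<bar> = K y" and f: "AE y in lborel. ennreal \<bar>f y\<bar> \<le> F y"
    and t: "0 \<le> t"
  shows "AE x in lborel. ennreal \<bar>green_op J t f x\<bar> \<le> pgreen K (enn2real (Lq_norm 1 J)) t F x"
proof -
  have "AE x in lborel. ennreal \<bar>(conv_op J ^^ k) f x\<bar> \<le> (pconv K ^^ k) F x" for k
  proof (induction k)
    case (Suc k)
    show ?case using conv_op_le_pconv[OF K Suc] by simp
  qed (use f in simp)
  then have "AE x in lborel. \<forall>k. ennreal \<bar>(conv_op J ^^ k) f x\<bar> \<le> (pconv K ^^ k) F x"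
    by (simp add: AE_all_countable)
  then show ?thesis
  proof eventually_elim
    case (elim x)
    let ?a = "\<lambda>k. t ^ k / fact k * (conv_op J ^^ k) f x" and ?e = "exp (- enn2real (Lq_norm 1 J) * t)"
    have "ennreal \<bar>green_op J t f x\<bar> = ennreal ?e * ennreal \<bar>\<Sum>k. ?a k\<bar>"
      by (simp add: green_op_def abs_mult ennreal_mult)
    also have "\<dots> \<le> ennreal ?e * (\<Sum>k. ennreal \<bar>?a k\<bar>)"
      by (intro mult_left_mono ennreal_abs_suminf_le) simp
    also have "\<dots> \<le> pgreen K (enn2real (Lq_norm 1 J)) t F x"
      unfolding pgreen_def
      using elim t by (intro mult_left_mono suminf_le) (auto simp: abs_mult ennreal_mult simp del: times_divide_eq_left intro!: mult_left_mono)
    finally show ?case .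
  qed
qed

section \<open>Transfer to the weighted Lebesgue norms\<close>

text \<open>Taking roots of the integral inequality. The integrals are over \<open>lborel\<close>,
  where the positive operators live; nonnegative integrals do not change under completion.\<close>

lemma Lq_norm_le_finite:
  fixes f g :: "'a::euclidean_space \<Rightarrow> real"
  assumes "1 \<le> q" "q \<noteq> \<infinity>" "0 < D"
    and le: "(\<integral>\<^sup>+x. ennreal (\<bar>g x\<bar> powr enn2real q) \<partial>lborel)
      \<le> ennreal (D powr enn2real q) * (\<integral>\<^sup>+x. ennreal (\<bar>f x\<bar> powr enn2real q) \<partial>lborel)"
  shows "Lq_norm q g \<le> ennreal D * Lq_norm q f"
proof -
  define r where "r = enn2real q"
  have r: "0 < r" using assms(1,2) by (auto simp: r_def enn2real_positive_iff less_top intro: less_le_trans[of _ 1])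
  let ?I = "\<lambda>f :: 'a \<Rightarrow> real. (\<integral>\<^sup>+x. ennreal (\<bar>f x\<bar> powr r) \<partial>lborel)"
  have norm: "Lq_norm q f = (if ?I f = \<infinity> then \<infinity> else ennreal (enn2real (?I f) powr (1 / r)))" for f :: "'a \<Rightarrow> real"
    using assms(2) by (simp add: Lq_norm_def r_def nn_integral_completion Let_def)
  show ?thesis
  proof (cases "?I f = \<infinity>")
    case True
    then show ?thesis using \<open>0 < D\<close> by (simp add: norm ennreal_mult_top)
  next
    case False
    then obtain i where i: "?I f = ennreal i" "0 \<le> i" by (metis ennreal_cases infinity_ennreal_def)
    then have "?I g \<le> ennreal (D powr r * i)" using le by (simp add: r_def ennreal_mult)
    then have "?I g \<noteq> top" by (auto simp: top_unique)
    then obtain j where j: "?I g = ennreal j" "0 \<le> j" by (metis ennreal_cases)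
    with \<open>?I g \<le> _\<close> i have j_le: "j \<le> D powr r * i" by (simp add: ennreal_le_iff)
    have "j powr (1 / r) \<le> (D powr r * i) powr (1 / r)"
      using j j_le r by (intro powr_mono2) auto
    also have "\<dots> = D * i powr (1 / r)"
      using i r \<open>0 < D\<close> by (simp add: powr_mult powr_powr)
    finally show ?thesis
      using i j \<open>0 < D\<close> by (simp add: norm ennreal_mult'[symmetric] ennreal_leI)
  qed
qed

text \<open>\<open>s + (norm x)\<^sup>2\<close> lies between \<open>1 + (norm x)\<^sup>2\<close> and
  \<open>s\<close> times it. The normalisation \<open>c\<close> is 1 for \<open>0 \<le> p\<close>
  and \<open>s powr \<bar>p\<bar>\<close> otherwise, so the two comparisons together lose exactly
  \<open>s powr \<bar>p\<bar>\<close>.\<close>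

lemma weight_compare:
  assumes s: "1 \<le> s"
  obtains c where "0 < c"
    and "\<And>x::'a::real_normed_vector. weight 1 p x \<le> c * weight s p x"
    and "\<And>x::'a. c * weight s p x \<le> s powr \<bar>p\<bar> * weight 1 p x"
proof -
  have pos: "0 < 1 + (norm x)\<^sup>2" "0 < s + (norm x)\<^sup>2" for x :: 'a
    using s by (auto simp: add_pos_nonneg)
  have le: "1 + (norm x)\<^sup>2 \<le> s + (norm x)\<^sup>2" "s + (norm x)\<^sup>2 \<le> s * (1 + (norm x)\<^sup>2)" for x :: 'a
    using s mult_right_mono[OF s, of "(norm x)\<^sup>2"] by (auto simp: distrib_left)
  show ?thesis
  proof (cases "0 \<le> p")
    case True
    show ?thesis
    proof (rule that[of 1])
      fix x :: 'a
      show "weight 1 p x \<le> 1 * weight s p x"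
        using le(1)[of x] pos(1)[of x] True by (simp add: weight_def powr_mono2)
      have "(s + (norm x)\<^sup>2) powr p \<le> (s * (1 + (norm x)\<^sup>2)) powr p"
        using le(2)[of x] pos(2)[of x] True by (intro powr_mono2) auto
      then show "1 * weight s p x \<le> s powr \<bar>p\<bar> * weight 1 p x"
        using True s pos(1)[of x] by (simp add: weight_def powr_mult)
    qed simp
  next
    case False
    show ?thesis
    proof (rule that[of "s powr \<bar>p\<bar>"])
      fix x :: 'a
      have "(s * (1 + (norm x)\<^sup>2)) powr p \<le> (s + (norm x)\<^sup>2) powr p"
        using le(2)[of x] pos(2)[of x] False by (intro powr_mono2') auto
      then have "s powr (- p) * (s powr p * weight 1 p x) \<le> s powr (- p) * weight s p x"
        using s pos(1)[of x] by (intro mult_left_mono) (simp_all add: weight_def powr_mult)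
      moreover have "s powr (- p) * s powr p = 1" using s by (simp add: powr_add[symmetric])
      ultimately show "weight 1 p x \<le> s powr \<bar>p\<bar> * weight s p x"
        using False by (simp add: mult.assoc[symmetric])
      have "(s + (norm x)\<^sup>2) powr p \<le> (1 + (norm x)\<^sup>2) powr p"
        using le(1)[of x] pos(1)[of x] False by (intro powr_mono2') auto
      then show "s powr \<bar>p\<bar> * weight s p x \<le> s powr \<bar>p\<bar> * weight 1 p x"
        by (simp add: weight_def mult_left_mono)
    qed (use s in simp)
  qed
qed

text \<open>Finite exponents use the Schur test, the infinite one only the bound for
  \<open>1 / W\<close>. Domination is assumed for all majorants \<open>F\<close> because the two
  cases choose different ones: a Borel version of the modulus of \<open>f\<close>, and a multiple of
  the reciprocal bracket weight.\<close>

lemma weighted_Lq_norm_le: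
  fixes f g W :: "'a::euclidean_space \<Rightarrow> real" and K :: "'a \<Rightarrow> ennreal"
  assumes K [measurable]: "K \<in> borel_measurable borel" and W [measurable]: "W \<in> borel_measurable borel"
    and Wpos: "\<And>x. 0 < W x"
    and V: "\<And>x. pconv K (\<lambda>x. ennreal (1 / W x)) x \<le> ennreal \<kappa> * ennreal (1 / W x)"
    and V': "\<And>y. (\<integral>\<^sup>+x. K (x - y) * ennreal (W x) \<partial>lborel) \<le> ennreal \<kappa> * ennreal (W y)"
    and t: "0 \<le> t" "0 \<le> \<kappa>" and q: "1 \<le> q" and c: "0 < c" "0 < D"
    and w1: "\<And>x. japanese_bracket x powr b \<le> c * W x"
    and w2: "\<And>x. c * W x \<le> D * japanese_bracket x powr b"
    and f: "f \<in> borel_measurable lebesgue" and g: "g \<in> borel_measurable lebesgue"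
    and le: "\<And>F. AE x in lborel. ennreal \<bar>f x\<bar> \<le> F x \<Longrightarrow>
      AE x in lborel. ennreal \<bar>g x\<bar> \<le> pgreen K \<alpha> t F x"
  shows "weighted_Lq_norm q b g \<le> ennreal (D * exp ((\<kappa> - \<alpha>) * t)) * weighted_Lq_norm q b f"
proof -
  define M where "M = exp ((\<kappa> - \<alpha>) * t)"
  define w where "w x = japanese_bracket x powr b" for x :: 'a
  have M0: "0 < M" by (simp add: M_def)
  have w0: "0 < w x" for x
    using japanese_bracket_ge_1[of x] by (simp add: w_def)
  have w_borel [measurable]: "w \<in> borel_measurable borel"
    unfolding w_def japanese_bracket_powr by measurable
  have w_leb: "w \<in> borel_measurable lebesgue"
    by (rule measurable_completion) simp
  show ?thesis
  proof (cases "q = \<infinity>")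
    case False
    define r where "r = enn2real q"
    have r: "1 \<le> r" using q False unfolding r_def
      by (cases q) (auto simp: ennreal_le_1 simp flip: ennreal_1)
    obtain f' :: "'a \<Rightarrow> real" where [measurable]: "f' \<in> borel_measurable borel"
      and f': "AE y in lborel. f y = f' y"
      using completion_ex_borel_measurable_real[OF f] by auto
    have "AE x in lborel. ennreal \<bar>g x\<bar> \<le> pgreen K \<alpha> t (\<lambda>x. ennreal \<bar>f' x\<bar>) x"
      by (rule le) (use f' in \<open>eventually_elim, simp\<close>)
    then have schur: "(\<integral>\<^sup>+x. ennreal ((W x * \<bar>g x\<bar>) powr r) \<partial>lborel)
        \<le> ennreal (M powr r) * (\<integral>\<^sup>+x. ennreal ((W x * \<bar>f' x\<bar>) powr r) \<partial>lborel)"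
      unfolding M_def by (intro schur_test[OF K _ W Wpos _ V V' t r]) auto
    have "(\<integral>\<^sup>+x. ennreal (\<bar>w x * g x\<bar> powr r) \<partial>lborel)
        \<le> (\<integral>\<^sup>+x. ennreal (c powr r * (W x * \<bar>g x\<bar>) powr r) \<partial>lborel)"
    proof (intro nn_integral_mono ennreal_leI)
      fix x
      have "\<bar>w x * g x\<bar> \<le> c * (W x * \<bar>g x\<bar>)"
        using mult_right_mono[OF w1[of x], of "\<bar>g x\<bar>"] w0[of x]
        by (simp add: w_def abs_mult mult.assoc)
      then have "\<bar>w x * g x\<bar> powr r \<le> (c * (W x * \<bar>g x\<bar>)) powr r"
        using r by (intro powr_mono2) auto
      then show "\<bar>w x * g x\<bar> powr r \<le> c powr r * (W x * \<bar>g x\<bar>) powr r"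
        using c Wpos[of x] by (simp add: powr_mult)
    qed
    also have "\<dots> = ennreal (c powr r) * (\<integral>\<^sup>+x. ennreal ((W x * \<bar>g x\<bar>) powr r) \<partial>lborel)"
    proof -
      \<comment> \<open>\<open>g\<close> is only Lebesgue measurable, so the constant is pulled out
        over the completion.\<close>
      have [measurable]: "W \<in> borel_measurable lebesgue" "g \<in> borel_measurable lebesgue"
        by (rule measurable_completion, simp) (rule g)
      have "(\<integral>\<^sup>+x. ennreal (c powr r * (W x * \<bar>g x\<bar>) powr r) \<partial>lebesgue)
          = ennreal (c powr r) * (\<integral>\<^sup>+x. ennreal ((W x * \<bar>g x\<bar>) powr r) \<partial>lebesgue)"
        by (simp add: ennreal_mult nn_integral_cmult)
      then show ?thesis by (simp add: nn_integral_completion)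
    qed
    also have "\<dots> \<le> ennreal (c powr r) * (ennreal (M powr r) * (\<integral>\<^sup>+x. ennreal ((W x * \<bar>f' x\<bar>) powr r) \<partial>lborel))"
      by (intro mult_left_mono schur) simp
    also have "\<dots> = (\<integral>\<^sup>+x. ennreal (M powr r) * ennreal (c powr r * (W x * \<bar>f' x\<bar>) powr r) \<partial>lborel)"
      by (simp add: nn_integral_cmult ennreal_mult ac_simps)
    also have "\<dots> \<le> (\<integral>\<^sup>+x. ennreal (M powr r) * ennreal (D powr r * \<bar>w x * f' x\<bar> powr r) \<partial>lborel)"
    proof (intro nn_integral_mono mult_left_mono ennreal_leI)
      fix x
      have "c * (W x * \<bar>f' x\<bar>) \<le> D * \<bar>w x * f' x\<bar>"
        using mult_right_mono[OF w2[of x], of "\<bar>f' x\<bar>"] w0[of x]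
        by (simp add: w_def abs_mult mult.assoc)
      then have "(c * (W x * \<bar>f' x\<bar>)) powr r \<le> (D * \<bar>w x * f' x\<bar>) powr r"
        using r c Wpos[of x] by (intro powr_mono2) auto
      then show "c powr r * (W x * \<bar>f' x\<bar>) powr r \<le> D powr r * \<bar>w x * f' x\<bar> powr r"
        using c Wpos[of x] by (simp add: powr_mult)
    qed simp
    also have "\<dots> = ennreal ((D * M) powr r) * (\<integral>\<^sup>+x. ennreal (\<bar>w x * f' x\<bar> powr r) \<partial>lborel)"
      using c M0 by (simp add: nn_integral_cmult ennreal_mult powr_mult ac_simps)
    also have "(\<integral>\<^sup>+x. ennreal (\<bar>w x * f' x\<bar> powr r) \<partial>lborel) = (\<integral>\<^sup>+x. ennreal (\<bar>w x * f x\<bar> powr r) \<partial>lborel)"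
      by (rule nn_integral_cong_AE) (use f' in \<open>eventually_elim, simp\<close>)
    finally show ?thesis
      unfolding weighted_Lq_norm_def M_def[symmetric] w_def[symmetric]
      using q False c M0 by (intro Lq_norm_le_finite) (auto simp: r_def)
  next
    case True
    define H where "H = esssup lebesgue (\<lambda>x. ennreal \<bar>w x * f x\<bar>)"
    have norm: "weighted_Lq_norm q b f = esssup lebesgue (\<lambda>x. ennreal \<bar>w x * f x\<bar>)" for f
      by (simp add: weighted_Lq_norm_def Lq_norm_def True w_def)
    have "AE x in lebesgue. ennreal \<bar>w x * f x\<bar> \<le> H"
      unfolding H_def by (rule esssup_AE)
    then have "AE x in lborel. ennreal \<bar>w x * f x\<bar> \<le> H" by (simp add: AE_completion_iff)
    then have "AE x in lborel. ennreal \<bar>f x\<bar> \<le> H * ennreal (1 / w x)"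
    proof eventually_elim
      case (elim x)
      have "ennreal \<bar>f x\<bar> = ennreal \<bar>w x * f x\<bar> * ennreal (1 / w x)"
        using w0[of x] by (simp add: ennreal_mult[symmetric] abs_mult)
      also have "\<dots> \<le> H * ennreal (1 / w x)" by (rule mult_right_mono[OF elim]) simp
      finally show ?case .
    qed
    from le[OF this] have "AE x in lborel. ennreal \<bar>w x * g x\<bar> \<le> ennreal (D * M) * H"
    proof eventually_elim
      case (elim x)
      \<comment> \<open>The majorant is at most a constant multiple of \<open>1 / W\<close>, which
        the Green operator reproduces up to the exponential; the \<open>G\<close> term of
        \<open>pgreen_le\<close> is switched off.\<close>
      have "pgreen K \<alpha> t (\<lambda>x. H * ennreal (1 / w x)) x
          \<le> 0 * pgreen K \<alpha> t (\<lambda>_. 0) x + (H * ennreal (D / c)) * ennreal (exp ((\<kappa> - \<alpha>) * t)) * ennreal (1 / W x)"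
      proof (rule pgreen_le[OF _ _ _ V _ t])
        fix y
        have "1 / w y \<le> D / c * (1 / W y)"
          using w2[of y] w0[of y] c Wpos[of y] by (simp add: w_def field_simps)
        then have "ennreal (1 / w y) \<le> ennreal (D / c) * ennreal (1 / W y)"
          using c Wpos[of y] by (simp add: ennreal_mult[symmetric] ennreal_leI del: times_divide_eq_left times_divide_eq_right)
        from mult_left_mono[OF this, of H]
        show "H * ennreal (1 / w y) \<le> 0 * 0 + H * ennreal (D / c) * ennreal (1 / W y)"
          by (simp add: mult.assoc)
      qed measurable
      then have "ennreal \<bar>g x\<bar> \<le> H * ennreal (D / c * M / W x)"
        using elim c M0 Wpos[of x] unfolding M_def[symmetric]
        by (simp add: ennreal_mult[symmetric] mult.assoc)
      then have "ennreal (w x) * ennreal \<bar>g x\<bar> \<le> ennreal (c * W x) * (H * ennreal (D / c * M / W x))"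
        using w1[of x] by (intro mult_mono ennreal_leI) (auto simp: w_def)
      also have "\<dots> = ennreal (c * W x * (D / c * M / W x)) * H"
        using c Wpos[of x] M0 by (subst ennreal_mult) (auto simp: ac_simps)
      also have "c * W x * (D / c * M / W x) = D * M"
        using c Wpos[of x] by simp
      finally show ?case
        using w0[of x] by (simp add: abs_mult ennreal_mult)
    qed
    then have "AE x in lebesgue. ennreal \<bar>w x * g x\<bar> \<le> ennreal (D * M) * H"
      by (simp add: AE_completion_iff)
    then show ?thesis
      unfolding norm H_def[symmetric] M_def[symmetric]
      by (intro esssup_I) (use w_leb g in measurable)
  qed
qed

section \<open>Moments of the kernel and the final estimate\<close>

theorem theorem1p1:
  fixes J :: "real ^ 'n \<Rightarrow> real" and \<delta> b :: real and q :: ennreal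
  assumes "J \<in> borel_measurable lebesgue"
    and "radially_symmetric J"
    and "\<delta> \<ge> 2"
    and "J \<in> weighted_Lq 1 \<delta>"
    and "\<bar>b\<bar> \<le> \<delta> - 2"
    and "1 \<le> q"
  shows "\<exists>C\<ge>0. \<forall>t\<ge>0. \<forall>f \<in> weighted_Lq q b.
      green_op J t f \<in> weighted_Lq q b \<and>
      weighted_Lq_norm q b (green_op J t f)
        \<le> ennreal (C * japanese_bracket t powr (\<bar>b\<bar> / 2)) * weighted_Lq_norm q b f"
proof -
  define P where "P = \<bar>b / 2\<bar>"
  have b: "\<bar>b\<bar> / 2 = P" by (simp add: P_def)
  have P0: "0 \<le> P" by (simp add: P_def)
  have "(\<lambda>x. ennreal \<bar>J x\<bar>) \<in> borel_measurable lebesgue" using assms(1) by measurable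
  then obtain K where K [measurable]: "K \<in> borel_measurable borel"
    and KJ: "AE y in lborel. ennreal \<bar>J y\<bar> = K y"
    using completion_ex_borel_measurable[of "\<lambda>x. ennreal \<bar>J x\<bar>" lborel] by auto
  have JK: "AE y in lborel. ennreal \<bar>J (- y)\<bar> = K (- y)"
    using AE_lborel_reflect[OF KJ, of 0] by simp
  \<comment> \<open>Radial symmetry enters as evenness, and passes from \<open>J\<close> to its
    Borel majorant almost everywhere.\<close>
  have even: "AE y in lborel. K (- y) = K y"
    using KJ JK
  proof eventually_elim
    case (elim y)
    have "J (- y) = J y"
      by (rule assms(2)[unfolded radially_symmetric_def, rule_format]) simp
    then show ?case using elim by simp
  qed
  define \<alpha> where "\<alpha> = enn2real (Lq_norm 1 J)"
  define m where "m = enn2real (\<integral>\<^sup>+y. K y * ennreal (weight 1 (P + 1) y) \<partial>lborel)"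
  \<comment> \<open>The weight is the bracket to the power \<open>\<bar>b\<bar> + 2\<close>, which
    is at most \<open>\<delta>\<close>: the two extra powers are the price of the second-order
    gain.\<close>
  have fin: "(\<integral>\<^sup>+y. K y * ennreal (weight 1 (P + 1) y) \<partial>lborel) < \<infinity>"
  proof -
    have "(\<integral>\<^sup>+y. ennreal \<bar>japanese_bracket y powr \<delta> * J y\<bar> \<partial>lborel) \<noteq> \<infinity>"
      using assms(4) unfolding weighted_Lq_def weighted_Lq_norm_def Lq_norm_def
      by (auto simp: Let_def nn_integral_completion split: if_splits)
    moreover have "(\<integral>\<^sup>+y. K y * ennreal (weight 1 (P + 1) y) \<partial>lborel)
        \<le> (\<integral>\<^sup>+y. ennreal \<bar>japanese_bracket y powr \<delta> * J y\<bar> \<partial>lborel)"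
    proof (rule nn_integral_mono_AE, use KJ in eventually_elim)
      case (elim y)
      have "weight 1 (P + 1) y = japanese_bracket y powr (2 * P + 2)"
        by (simp add: japanese_bracket_powr add_divide_distrib)
      also have "\<dots> \<le> japanese_bracket y powr \<delta>"
        using assms(5) b by (intro powr_mono japanese_bracket_ge_1) auto
      finally have "\<bar>J y\<bar> * weight 1 (P + 1) y \<le> \<bar>japanese_bracket y powr \<delta> * J y\<bar>"
        by (simp add: abs_mult mult.commute[of _ "\<bar>J y\<bar>"] mult_left_mono)
      then show ?case
        unfolding elim[symmetric] by (simp add: ennreal_mult[symmetric] ennreal_leI)
    qed
    ultimately show ?thesis by (simp add: less_top top_unique)
  qed
  have m: "(\<integral>\<^sup>+y. K y * ennreal (weight 1 (P + 1) y) \<partial>lborel) \<le> ennreal m"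
    using fin by (simp add: m_def)
  \<comment> \<open>\<open>enn2real\<close> sends infinity to 0, so the kernel must be shown
    integrable before \<open>\<alpha>\<close> can bound its integral.\<close>
  have \<alpha>: "(\<integral>\<^sup>+y. K y \<partial>lborel) \<le> ennreal \<alpha>"
  proof -
    have eq: "(\<integral>\<^sup>+y. ennreal \<bar>J y\<bar> \<partial>lborel) = (\<integral>\<^sup>+y. K y \<partial>lborel)"
      by (rule nn_integral_cong_AE) (fact KJ)
    have "(\<integral>\<^sup>+y. K y \<partial>lborel) \<le> (\<integral>\<^sup>+y. K y * ennreal (weight 1 (P + 1) y) \<partial>lborel)"
    proof (rule nn_integral_mono)
      fix y :: "real ^ 'n"
      have "1 \<le> weight 1 (P + 1) y"
        unfolding weight_def using P0 by (intro ge_one_powr_ge_zero) auto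
      then have "1 \<le> ennreal (weight 1 (P + 1) y)" by simp
      from mult_left_mono[OF this, of "K y"] show "K y \<le> K y * ennreal (weight 1 (P + 1) y)" by simp
    qed
    with fin have "(\<integral>\<^sup>+y. K y \<partial>lborel) < \<infinity>" by (rule le_less_trans[rotated])
    then show ?thesis
      by (auto simp: \<alpha>_def Lq_norm_def Let_def nn_integral_completion eq)
  qed
  have nonneg: "0 \<le> \<alpha>" "0 \<le> m" by (simp_all add: \<alpha>_def m_def)
  obtain C where C0: "0 \<le> C" and C: "\<And>p s (x :: real ^ 'n) y. \<bar>p\<bar> = P \<Longrightarrow> 1 \<le> s \<Longrightarrow>
      weight s p (x + y) + weight s p (x - y) \<le> 2 * (1 + C * weight 1 (P + 1) y / s) * weight s p x"
    using weight_second_difference[where 'a = "real ^ 'n"] by blast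
  have bound: "weighted_Lq_norm q b (green_op J t f)
      \<le> ennreal (exp (C * m) * japanese_bracket t powr (\<bar>b\<bar> / 2)) * weighted_Lq_norm q b f"
    if t: "0 \<le> t" and f: "f \<in> borel_measurable lebesgue" for t f
  proof -
    \<comment> \<open>This choice keeps \<open>(\<kappa> - \<alpha>) * t = C * m * (t / s)\<close>
      below \<open>C * m\<close>, while comparing the weights costs the claimed power of the bracket
      of \<open>t\<close>.\<close>
    define s where "s = japanese_bracket t"
    define \<kappa> where "\<kappa> = \<alpha> + C * m / s"
    have s: "1 \<le> s" by (simp add: s_def japanese_bracket_ge_1)
    have "t \<le> sqrt (1 + t\<^sup>2)" by (rule real_le_rsqrt) simp
    then have ts: "t \<le> s" by (simp add: s_def japanese_bracket_def)
    have step: "pconv K (\<lambda>x. ennreal (weight s p x)) x \<le> ennreal \<kappa> * ennreal (weight s p x)"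
      if "\<bar>p\<bar> = P" for p x
      unfolding \<kappa>_def
      by (rule pconv_weight_le[OF K even s nonneg C0 \<alpha>]) (use m C[OF that] in \<open>simp_all add: that\<close>)
    obtain c where c: "0 < c" "\<And>x :: real ^ 'n. weight 1 (b / 2) x \<le> c * weight s (b / 2) x"
        "\<And>x :: real ^ 'n. c * weight s (b / 2) x \<le> s powr \<bar>b / 2\<bar> * weight 1 (b / 2) x"
      using weight_compare[OF s, where 'a = "real ^ 'n" and p = "b / 2"] by blast
    have "weighted_Lq_norm q b (green_op J t f)
        \<le> ennreal (s powr P * exp ((\<kappa> - \<alpha>) * t)) * weighted_Lq_norm q b f"
    proof (rule weighted_Lq_norm_le[where K = K and W = "weight s (b / 2)" and c = c])
      \<comment> \<open>The reciprocal is the weight with exponent \<open>- (b / 2)\<close>, again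
        of modulus \<open>P\<close>, so the same \<open>C\<close> and \<open>m\<close>
        apply.\<close>
      show "pconv K (\<lambda>x. ennreal (1 / weight s (b / 2) x)) x \<le> ennreal \<kappa> * ennreal (1 / weight s (b / 2) x)" for x
        unfolding weight_minus[OF s, symmetric] by (rule step) (simp add: P_def)
      show "(\<integral>\<^sup>+x. K (x - y) * ennreal (weight s (b / 2) x) \<partial>lborel) \<le> ennreal \<kappa> * ennreal (weight s (b / 2) y)" for y
        unfolding nn_integral_even_kernel[OF even] by (rule step) (simp add: P_def)
      show "AE x in lborel. ennreal \<bar>green_op J t f x\<bar> \<le> pgreen K \<alpha> t F x"
        if "AE x in lborel. ennreal \<bar>f x\<bar> \<le> F x" for F
        unfolding \<alpha>_def by (rule green_op_le_pgreen[OF KJ that t])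
    qed (use c s t f nonneg C0 assms(6) in \<open>auto simp: weight_pos \<kappa>_def japanese_bracket_powr P_def
      intro: green_op_lebesgue_measurable[OF assms(1)]\<close>)
    also have "\<dots> \<le> ennreal (exp (C * m) * s powr P) * weighted_Lq_norm q b f"
    proof (intro mult_right_mono ennreal_leI)
      have "(\<kappa> - \<alpha>) * t = C * m * (t / s)" by (simp add: \<kappa>_def)
      also have "\<dots> \<le> C * m * 1" using ts s C0 nonneg by (intro mult_left_mono) auto
      finally show "s powr P * exp ((\<kappa> - \<alpha>) * t) \<le> exp (C * m) * s powr P"
        by (simp add: mult.commute mult_left_mono)
    qed simp
    finally show ?thesis by (simp add: s_def b)
  qed
  show ?thesis
  proof (intro exI[of _ "exp (C * m)"] conjI allI impI ballI)
    fix t :: real and f :: "real ^ 'n \<Rightarrow> real"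
    assume t: "0 \<le> t" and "f \<in> weighted_Lq q b"
    then have f: "f \<in> borel_measurable lebesgue" "weighted_Lq_norm q b f < \<infinity>"
      by (auto simp: weighted_Lq_def)
    show le: "weighted_Lq_norm q b (green_op J t f)
        \<le> ennreal (exp (C * m) * japanese_bracket t powr (\<bar>b\<bar> / 2)) * weighted_Lq_norm q b f"
      by (rule bound) fact+
    also have "\<dots> < \<infinity>" using f(2) by (simp add: ennreal_mult_less_top)
    finally show "green_op J t f \<in> weighted_Lq q b"
      using green_op_lebesgue_measurable[OF assms(1) f(1)] by (simp add: weighted_Lq_def)
  qed simp
qed

end
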